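(* Let $k$ be a positive integer and let $G$ be a finite $k$-regular graph with chromatic index $\chi'(G)=k$ (i.e., $G$ is 1-factorable). Then $q(G \mathbin{\tilde\boxtimes} K_k)=2$, where $\mathbin{\tilde\boxtimes}$ denotes the modified strong product and $K_k$ is the complete graph on $k$ vertices.
   Context: For a finite simple graph $G$ on vertex set $\{1,\dots,n\}$, $\mathcal{S}(G)$ denotes the set of real symmetric $n\times n$ matrices $A=[a_{ij}]$ such that for $i\neq j$, $a_{ij}\neq 0$ if and only if $ij$ is an edge of $G$ (diagonal entries are unrestricted). For a symmetric matrix $A$, $q(A)$ is the number of distinct eigenvalues of $A$, and $q(G)=\min\{q(A) : A\in\mathcal{S}(G)\}$. The chromatic index $\chi'(G)$ is the minimum number of colors in a proper edge coloring of $G$. The modified strong product $G\mathbin{\tilde\boxtimes} H$ of graphs $G,H$ is the graph on vertex set $V(G)\times V(H)$ whose edges are exactly: $(g,h)(g',h)$ where $gg'\in E(G)$, and $(g,h)(g',h')$ where $gg'\in E(G)$ and $hh'\in E(H)$. (Equivalently its adjacency matrix is $A_G\otimes(A_H+I)$; edges $(g,h)(g,h')$ with $hh'\in E(H)$ are not included.) *)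

theory Defs
  imports
    "Jordan_Normal_Form.Spectral_Radius"
    "Graph_Theory.Pair_Digraph"
    "Graph_Theory.Kuratowski"
begin

text \<open>
  A finite simple graph is a \<open>pair_graph\<close>: a finite, symmetric, loop-free digraph whose arcs
  are pairs, so an edge \<open>uv\<close> is present as the two arcs \<open>(u, v)\<close> and \<open>(v, u)\<close>.
  \<open>K\<^sub>k\<close> is any graph satisfying \<^const>\<open>complete_digraph\<close> with parameter \<open>k\<close>.
\<close>

definition regular_graph :: "nat \<Rightarrow> 'a pair_pre_digraph \<Rightarrow> bool" where
  "regular_graph k G \<longleftrightarrow> (\<forall>v \<in> pverts G. out_degree (with_proj G) v = k)"

definition edges :: "'a pair_pre_digraph \<Rightarrow> 'a set set" where
  "edges G = {{u, v} | u v. (u, v) \<in> parcs G}"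

definition proper_edge_coloring :: "'a pair_pre_digraph \<Rightarrow> nat \<Rightarrow> ('a set \<Rightarrow> nat) \<Rightarrow> bool" where
  "proper_edge_coloring G m c \<longleftrightarrow>
     c ` edges G \<subseteq> {..<m} \<and>
     (\<forall>e \<in> edges G. \<forall>e' \<in> edges G. e \<noteq> e' \<and> e \<inter> e' \<noteq> {} \<longrightarrow> c e \<noteq> c e')"

definition chromatic_index :: "'a pair_pre_digraph \<Rightarrow> nat" where
  "chromatic_index G = (LEAST m. \<exists>c. proper_edge_coloring G m c)"

definition modified_strong_product ::
  "'a pair_pre_digraph \<Rightarrow> 'b pair_pre_digraph \<Rightarrow> ('a \<times> 'b) pair_pre_digraph" where
  "modified_strong_product G H =
     \<lparr> pverts = pverts G \<times> pverts H,
       parcs = {((g, h), (g', h')) | g h g' h'.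
         (g, g') \<in> parcs G \<and> (h \<in> pverts H \<and> h = h' \<or> (h, h') \<in> parcs H)} \<rparr>"

text \<open>
  Matrices have rows and columns indexed by \<open>0, \<dots>, n - 1\<close>, while the vertices of \<open>G\<close> are
  arbitrary, so a matrix of \<open>G\<close> is taken with respect to some labelling \<open>f\<close> of the vertices.
  A change of labelling is a simultaneous permutation of rows and columns and does not
  affect eigenvalues. For a graph on \<open>{0..<n}\<close> this set is the union of the permuted copies of
  \<open>S(G)\<close>.
\<close>

definition sym_matrices :: "'a pair_pre_digraph \<Rightarrow> real mat set" where
  "sym_matrices G =
     {A \<in> carrier_mat (card (pverts G)) (card (pverts G)).
        transpose_mat A = A \<and>
        (\<exists>f. bij_betw f {0..<card (pverts G)} (pverts G) \<and>
          (\<forall>i < card (pverts G). \<forall>j < card (pverts G).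
             i \<noteq> j \<longrightarrow> (A $$ (i, j) \<noteq> 0 \<longleftrightarrow> (f i, f j) \<in> parcs G)))}"

text \<open>
  The spectrum below consists of the real eigenvalues only; for the real symmetric matrices
  considered here these are all eigenvalues.
\<close>

definition q_mat :: "real mat \<Rightarrow> nat" where
  "q_mat A = card (spectrum A)"

definition q_graph :: "'a pair_pre_digraph \<Rightarrow> nat" where
  "q_graph G = (LEAST m. \<exists>A \<in> sym_matrices G. q_mat A = m)"

lemma pair_graph_modified_strong_product:
  assumes "pair_graph G" "pair_graph H"
  shows "pair_graph (modified_strong_product G H)"
proof -
  interpret G: pair_graph G by fact
  interpret H: pair_graph H by fact
  let ?P = "modified_strong_product G H"
  have sub: "parcs ?P \<subseteq> pverts ?P \<times> pverts ?P"
    by (auto simp: modified_strong_product_def dest: G.wellformed' H.wellformed')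
  have fin: "finite (pverts ?P)"
    by (simp add: modified_strong_product_def G.pair_finite_verts H.pair_finite_verts)
  have "finite (parcs ?P)"
    using sub fin finite_subset by blast
  moreover have "symmetric (with_proj ?P)"
    using G.pair_sym_arcs H.pair_sym_arcs
    by (auto simp: modified_strong_product_def symmetric_def sym_def)
  moreover have "fst e \<noteq> snd e" if "e \<in> parcs ?P" for e
    using that G.pair_no_loops by (fastforce simp: modified_strong_product_def)
  ultimately show ?thesis
    using sub fin by unfold_locales auto
qed

lemma sym_matrices_nonempty:
  assumes "pair_graph G"
  shows "sym_matrices G \<noteq> {}"
proof -
  interpret pair_graph G by fact
  let ?n = "card (pverts G)"
  obtain f where f: "bij_betw f {0..<?n} (pverts G)"
    using ex_bij_betw_nat_finite pair_finite_verts by blast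
  define A :: "real mat" where
    "A = mat ?n ?n (\<lambda>(i, j). if (f i, f j) \<in> parcs G then 1 else 0)"
  have "(f i, f j) \<in> parcs G \<longleftrightarrow> (f j, f i) \<in> parcs G" for i j
    using pair_sym_arcs by (auto simp: symmetric_def sym_def)
  then have "transpose_mat A = A"
    by (intro eq_matI) (auto simp: A_def)
  then have "A \<in> sym_matrices G"
    using f by (auto simp: sym_matrices_def A_def)
  then show ?thesis by blast
qed

lemma q_graph_attained:
  assumes "pair_graph G"
  shows "\<exists>A \<in> sym_matrices G. q_mat A = q_graph G"
  unfolding q_graph_def
  by (rule LeastI_ex) (use sym_matrices_nonempty[OF assms] in blast)

lemma chromatic_index_attained:
  assumes "pair_graph G"
  shows "\<exists>c. proper_edge_coloring G (chromatic_index G) c"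
proof -
  interpret pair_graph G by fact
  have "edges G \<subseteq> Pow (pverts G)"
    by (auto simp: edges_def dest: wellformed')
  then have "finite (edges G)"
    using pair_finite_verts by (meson finite_Pow_iff finite_subset)
  then obtain c where "bij_betw c (edges G) {0..<card (edges G)}"
    using ex_bij_betw_finite_nat by blast
  then have c: "proper_edge_coloring G (card (edges G)) c"
    by (auto simp: proper_edge_coloring_def bij_betw_def inj_on_def)
  show ?thesis
    unfolding chromatic_index_def
    by (rule LeastI[where P = "\<lambda>m. \<exists>c. proper_edge_coloring G m c"]) (rule exI, rule c)
qed

end

theory Submission
  imports Defs
begin

text \<open>
  A proper colouring of the \<open>k\<close>-regular graph \<open>G\<close> with \<open>k\<close> colours splits it into perfect matchings
  with permutation matrices \<open>P\<^sub>1, \<dots>, P\<^sub>k\<close>. Let \<open>u\<^sub>1, \<dots>, u\<^sub>k\<close> be an orthonormal basis of \<open>k\<close>-space whose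
  vectors have no zero entry. Then \<open>A = \<Sum>\<^sub>i P\<^sub>i \<otimes> u\<^sub>iu\<^sub>i\<^sup>T\<close> has the pattern of the product graph, and
  since the projections \<open>u\<^sub>iu\<^sub>i\<^sup>T\<close> are mutually orthogonal with sum \<open>I\<close> and \<open>P\<^sub>i\<^sup>2 = I\<close>, also
  \<open>A\<^sup>2 = I\<close>; so \<open>A\<close> has at most the eigenvalues \<open>1\<close> and \<open>-1\<close>.
  Conversely, a real symmetric matrix with at most one eigenvalue is scalar, which the presence of an
  edge excludes.
\<close>

section \<open>Spectra of real symmetric matrices\<close>

lemma trace_mult_comm:
  fixes X Y :: "'a::comm_semiring_0 mat"
  assumes "X \<in> carrier_mat n m" "Y \<in> carrier_mat m n"
  shows "(\<Sum>i<n. (X * Y) $$ (i, i)) = (\<Sum>i<m. (Y * X) $$ (i, i))"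
proof -
  have "(\<Sum>i<n. (X * Y) $$ (i, i)) = (\<Sum>i<n. \<Sum>j<m. X $$ (i, j) * Y $$ (j, i))"
    using assms by (intro sum.cong refl) (auto simp: scalar_prod_def atLeast0LessThan)
  also have "\<dots> = (\<Sum>j<m. \<Sum>i<n. Y $$ (j, i) * X $$ (i, j))"
    by (subst sum.swap) (simp add: mult.commute)
  also have "\<dots> = (\<Sum>i<m. (Y * X) $$ (i, i))"
    using assms by (intro sum.cong refl) (auto simp: scalar_prod_def atLeast0LessThan)
  finally show ?thesis .
qed

text \<open>For \<open>i \<noteq> j\<close> one of the entries \<open>B $$ (i, j)\<close> and
  \<open>B $$ (j, i)\<close> lies below the diagonal, so only squares of diagonal entries
  survive.\<close>

lemma trace_square_upper_triangular:
  fixes B :: "'a::comm_semiring_1 mat"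
  assumes B: "B \<in> carrier_mat n n" and ut: "upper_triangular B"
  shows "(\<Sum>i<n. (B * B) $$ (i, i)) = (\<Sum>i<n. (B $$ (i, i))\<^sup>2)"
proof (intro sum.cong refl)
  fix i assume "i \<in> {..<n}"
  then have i: "i < n" by simp
  have "(B * B) $$ (i, i) = (\<Sum>j<n. B $$ (i, j) * B $$ (j, i))"
    using B i by (auto simp: scalar_prod_def atLeast0LessThan)
  also have "\<dots> = (\<Sum>j<n. if j = i then (B $$ (i, i))\<^sup>2 else 0)"
  proof (intro sum.cong refl)
    fix j assume "j \<in> {..<n}"
    then show "B $$ (i, j) * B $$ (j, i) = (if j = i then (B $$ (i, i))\<^sup>2 else 0)"
      using B i ut upper_triangularD[of B j i] upper_triangularD[of B i j]
      by (cases i j rule: linorder_cases) (auto simp: power2_eq_square)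
  qed
  also have "\<dots> = (B $$ (i, i))\<^sup>2" using i by simp
  finally show "(B * B) $$ (i, i) = (B $$ (i, i))\<^sup>2" .
qed

text \<open>Schur triangularization works over the complex numbers, while \<open>spectrum A\<close>
  holds real eigenvalues only; this is the passage between them. Realness comes from the Hermitian
  form, and the real eigenvalue from the shared characteristic polynomial.\<close>

lemma eigenvalue_real_symmetric:
  fixes A :: "real mat"
  assumes A: "A \<in> carrier_mat n n" and sym: "transpose_mat A = A"
    and ev: "eigenvalue (map_mat complex_of_real A) z"
  obtains r where "z = of_real r" "eigenvalue A r"
proof -
  let ?A = "map_mat complex_of_real A"
  have AC: "?A \<in> carrier_mat n n" using A by simp
  from ev obtain v where v: "v \<in> carrier_vec n" "v \<noteq> 0\<^sub>v n" "?A *\<^sub>v v = z \<cdot>\<^sub>v v"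
    using A unfolding eigenvalue_def eigenvector_def by auto
  \<comment> \<open>\<open>S\<close> is the squared norm of \<open>v\<close> and \<open>L\<close>
    the Hermitian form of \<open>A\<close> at \<open>v\<close>. Both are fixed by conjugation, so
    \<open>L = z * S\<close> with \<open>S \<noteq> 0\<close> makes \<open>z\<close> real.\<close>
  define S where "S = (\<Sum>i<n. v $ i * cnj (v $ i))"
  define L where "L = (\<Sum>i<n. \<Sum>j<n. of_real (A $$ (i, j)) * v $ j * cnj (v $ i))"
  have row: "(\<Sum>j<n. of_real (A $$ (i, j)) * v $ j) = z * v $ i" if "i < n" for i
    using arg_cong[OF v(3), of "\<lambda>w. w $ i"] that v(1) A
    by (simp add: scalar_prod_def atLeast0LessThan)
  have L: "L = z * S"
    unfolding L_def S_def sum_distrib_left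
    by (intro sum.cong refl) (simp add: row sum_distrib_right[symmetric] mult.assoc[symmetric])
  have A_swap: "A $$ (j, i) = A $$ (i, j)" if "i < n" "j < n" for i j
    using arg_cong[OF sym, of "\<lambda>M. M $$ (i, j)"] that A by simp
  have "cnj L = (\<Sum>i<n. \<Sum>j<n. of_real (A $$ (j, i)) * v $ i * cnj (v $ j))"
    unfolding L_def by (auto simp: A_swap intro!: sum.cong)
  also have "\<dots> = L" unfolding L_def by (rule sum.swap)
  finally have "cnj L = L" .
  moreover have "cnj S = S" unfolding S_def by (simp add: mult.commute)
  ultimately have "cnj z * S = z * S" using L by (metis complex_cnj_mult)
  moreover have "S \<noteq> 0"
  proof
    assume "S = 0"
    moreover have "S = of_real (\<Sum>i<n. (cmod (v $ i))\<^sup>2)"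
      unfolding S_def of_real_sum complex_norm_square ..
    ultimately have "(\<Sum>i<n. (cmod (v $ i))\<^sup>2) = 0" by (metis of_real_eq_0_iff)
    then have "\<forall>i<n. v $ i = 0" by (subst (asm) sum_nonneg_eq_0_iff) auto
    with v(1,2) show False by (metis eq_vecI carrier_vecD index_zero_vec)
  qed
  ultimately have "cnj z = z" by simp
  then obtain r where r: "z = of_real r" by (metis Reals_cnj_iff Reals_cases)
  have "poly (char_poly ?A) z = 0" using ev eigenvalue_root_char_poly[OF AC] by simp
  then have "poly (char_poly A) r = 0"
    by (simp add: r of_real_hom.char_poly_hom[OF A])
  then have "eigenvalue A r" using eigenvalue_root_char_poly[OF A] by simp
  with r that show thesis by blast
qed

text \<open>
  All complex eigenvalues of \<open>C = A - l I\<close> vanish, so by Schur triangularization the trace of \<open>C\<^sup>2\<close>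
  is \<open>0\<close>; by symmetry this trace is the sum of the squared entries of \<open>C\<close>.
\<close>

lemma symmetric_eigenvalues_all_eq:
  fixes A :: "real mat"
  assumes A: "A \<in> carrier_mat n n" and sym: "transpose_mat A = A"
    and spec: "spectrum A \<subseteq> {l}"
  shows "A = l \<cdot>\<^sub>m 1\<^sub>m n"
proof -
  define C where "C = map_mat complex_of_real (A - l \<cdot>\<^sub>m 1\<^sub>m n)"
  have symC: "transpose_mat (A - l \<cdot>\<^sub>m 1\<^sub>m n) = A - l \<cdot>\<^sub>m 1\<^sub>m n"
    using A sym by (intro eq_matI) (auto simp: mat_eq_iff)
  have NA: "A - l \<cdot>\<^sub>m 1\<^sub>m n \<in> carrier_mat n n" using A by auto
  have C: "C \<in> carrier_mat n n" using A by (auto simp: C_def)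
  \<comment> \<open>An eigenvalue of \<open>C\<close> is a real \<open>r\<close>, and undoing the
    shift makes \<open>r + l\<close> an eigenvalue of \<open>A\<close>, which must be
    \<open>l\<close>.\<close>
  have ev0: "z = 0" if ev: "eigenvalue C z" for z
  proof -
    obtain r where r: "z = of_real r" "eigenvalue (A - l \<cdot>\<^sub>m 1\<^sub>m n) r"
      using eigenvalue_real_symmetric[OF NA symC ev[unfolded C_def]] .
    from r(2) obtain v where v: "v \<in> carrier_vec n" "v \<noteq> 0\<^sub>v n"
      and e: "(A - l \<cdot>\<^sub>m 1\<^sub>m n) *\<^sub>v v = r \<cdot>\<^sub>v v"
      using NA unfolding eigenvalue_def eigenvector_def by auto
    have "(l \<cdot>\<^sub>m 1\<^sub>m n) *\<^sub>v v = l \<cdot>\<^sub>v v"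
      using v(1) by (intro eq_vecI) (auto simp: scalar_prod_def if_distrib[of "\<lambda>x. l * x * _"] cong: if_cong)
    then have "(A - l \<cdot>\<^sub>m 1\<^sub>m n) *\<^sub>v v = A *\<^sub>v v - l \<cdot>\<^sub>v v"
      using v(1) by (subst minus_mult_distrib_mat_vec[OF A]) auto
    then have "A *\<^sub>v v - l \<cdot>\<^sub>v v = r \<cdot>\<^sub>v v" using e by simp
    then have "A *\<^sub>v v = (r + l) \<cdot>\<^sub>v v"
      using A v(1) by (intro eq_vecI) (auto simp: vec_eq_iff algebra_simps)
    then have "eigenvalue A (r + l)"
      using A v unfolding eigenvalue_def eigenvector_def by auto
    then have "r + l \<in> spectrum A" by (simp add: spectrum_def)
    with spec r(1) show "z = 0" by auto
  qed
  obtain es where es: "char_poly C = (\<Prod>a\<leftarrow>es. [:- a, 1:])"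
    using char_poly_factorized[OF C] by blast
  have es0: "e = 0" if "e \<in> set es" for e
  proof -
    have "poly (char_poly C) e = 0"
      unfolding es poly_prod_list using that by (auto simp: prod_list_zero_iff)
    then show ?thesis using ev0 eigenvalue_root_char_poly[OF C] by simp
  qed
  obtain B P Q where "schur_decomposition C es = (B, P, Q)" by (metis prod_cases3)
  from schur_decomposition[OF C es this] have
    wit: "similar_mat_wit C B P Q" and ut: "upper_triangular B" and diag: "diag_mat B = es"
    by auto
  note w = similar_mat_witD2[OF C wit]
  \<comment> \<open>The diagonal of \<open>B\<close> lists the roots of the characteristic
    polynomial of \<open>C\<close>, all of which are 0.\<close>
  have B0: "B $$ (i, i) = 0" if "i < n" for i
    using es0[of "B $$ (i, i)"] diag w(5) that by (auto simp: diag_mat_def)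
  have QP: "Q * (P * X) = X" if "X \<in> carrier_mat n n" for X
    using w that by (simp add: assoc_mult_mat[of Q n n P n X n, symmetric])
  have CC: "C * C = P * (B * B) * Q"
    using w QP[of "B * Q"] by (simp add: assoc_mult_mat[of _ n n _ n _ n])
  have "(\<Sum>i<n. (C * C) $$ (i, i)) = (\<Sum>i<n. (Q * (P * (B * B))) $$ (i, i))"
    unfolding CC by (rule trace_mult_comm) (use w in auto)
  also have "Q * (P * (B * B)) = B * B"
    using w by (intro QP) simp
  also have "(\<Sum>i<n. (B * B) $$ (i, i)) = 0"
    unfolding trace_square_upper_triangular[OF w(5) ut] using B0 by simp
  finally have tr: "(\<Sum>i<n. (C * C) $$ (i, i)) = 0" .
  let ?N = "A - l \<cdot>\<^sub>m 1\<^sub>m n"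
  have swap: "?N $$ (j, i) = ?N $$ (i, j)" if "i < n" "j < n" for i j
    using arg_cong[OF symC, of "\<lambda>M. M $$ (i, j)"] that NA A by simp
  have "(\<Sum>i<n. (C * C) $$ (i, i)) = (\<Sum>i<n. \<Sum>j<n. C $$ (i, j) * C $$ (j, i))"
    using C by (intro sum.cong refl) (auto simp: scalar_prod_def atLeast0LessThan)
  also have "\<dots> = (\<Sum>i<n. \<Sum>j<n. of_real ((?N $$ (i, j))\<^sup>2))"
  proof (intro sum.cong refl)
    fix i j assume ij: "i \<in> {..<n}" "j \<in> {..<n}"
    have "C $$ (i, j) = of_real (?N $$ (i, j))" "C $$ (j, i) = of_real (?N $$ (i, j))"
      using ij NA swap[of i j] unfolding C_def by (auto simp del: index_minus_mat)
    then show "C $$ (i, j) * C $$ (j, i) = of_real ((?N $$ (i, j))\<^sup>2)"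
      by (simp only: power2_eq_square of_real_mult)
  qed
  also have "\<dots> = of_real (\<Sum>i<n. \<Sum>j<n. (?N $$ (i, j))\<^sup>2)" by simp
  finally have "0 = complex_of_real (\<Sum>i<n. \<Sum>j<n. (?N $$ (i, j))\<^sup>2)" unfolding tr .
  then have "(\<Sum>i<n. \<Sum>j<n. (?N $$ (i, j))\<^sup>2) = 0" by (rule of_real_eq_0_iff[THEN iffD1, OF HOL.sym])
  then have N0: "\<forall>i<n. \<forall>j<n. (?N $$ (i, j))\<^sup>2 = 0"
    by (simp add: sum_nonneg_eq_0_iff sum_nonneg del: index_minus_mat)
  show ?thesis
  proof (rule eq_matI)
    fix i j assume "i < dim_row (l \<cdot>\<^sub>m 1\<^sub>m n)" "j < dim_col (l \<cdot>\<^sub>m 1\<^sub>m n)"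
    then show "A $$ (i, j) = (l \<cdot>\<^sub>m 1\<^sub>m n) $$ (i, j)" using N0 A by auto
  qed (use A in auto)
qed

section \<open>Bounds for the number of eigenvalues\<close>

lemma two_le_q_mat:
  assumes A: "A \<in> carrier_mat n n" and sym: "transpose_mat A = A"
    and ij: "i < n" "j < n" "i \<noteq> j" "A $$ (i, j) \<noteq> 0"
  shows "2 \<le> q_mat A"
proof (rule ccontr)
  assume "\<not> 2 \<le> q_mat A"
  then have "card (spectrum A) \<le> 1" by (simp add: q_mat_def)
  \<comment> \<open>An inclusion, not an equation, so that an empty spectrum is covered as
    well.\<close>
  then obtain l where "spectrum A \<subseteq> {l}"
    using card_finite_spectrum(1)[OF A] by (metis card_le_Suc0_iff_eq insertI1 One_nat_def subsetI)
  from symmetric_eigenvalues_all_eq[OF A sym this] ij show False by simp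
qed

text \<open>Applying \<open>A\<close> twice fixes an eigenvector and also scales it by
  \<open>z\<^sup>2\<close>.\<close>

lemma q_mat_le_two:
  fixes A :: "real mat"
  assumes A: "A \<in> carrier_mat n n" and sq: "A * A = 1\<^sub>m n"
  shows "q_mat A \<le> 2"
proof -
  have "spectrum A \<subseteq> {1, -1}"
  proof
    fix z assume "z \<in> spectrum A"
    then obtain v where v: "v \<in> carrier_vec n" "v \<noteq> 0\<^sub>v n" "A *\<^sub>v v = z \<cdot>\<^sub>v v"
      using A unfolding spectrum_def eigenvalue_def eigenvector_def by auto
    have "v = (A * A) *\<^sub>v v" using sq v(1) by simp
    also have "\<dots> = A *\<^sub>v (z \<cdot>\<^sub>v v)" using A v by (simp add: assoc_mult_mat_vec[OF A A])
    also have "\<dots> = z\<^sup>2 \<cdot>\<^sub>v v"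
      using A v by (simp add: mult_mat_vec power2_eq_square smult_smult_assoc)
    finally have e: "v = z\<^sup>2 \<cdot>\<^sub>v v" .
    obtain i where i: "i < n" "v $ i \<noteq> 0"
      using v(1,2) by (metis eq_vecI carrier_vecD index_zero_vec)
    have "v $ i = z\<^sup>2 * v $ i" using arg_cong[OF e, of "\<lambda>w. w $ i"] i v(1) by simp
    then have "z\<^sup>2 = 1" using i by simp
    then show "z \<in> {1, -1}" by (simp add: power2_eq_1_iff)
  qed
  then have "card (spectrum A) \<le> card {1, -1 :: real}" by (intro card_mono) auto
  then show ?thesis by (simp add: q_mat_def)
qed


section \<open>A symmetric orthogonal matrix without zero entries\<close>

text \<open>
  The matrix is a reflection \<open>I - 2vv\<^sup>T\<close> with \<open>v\<^sub>i\<^sup>2 = 2\<^sup>i / (2\<^sup>k - 1)\<close>. Parity gives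
  \<open>v\<^sub>i\<^sup>2 \<noteq> 1/2\<close>, so the diagonal has no zero; the constant vector would fail for \<open>k = 2\<close>.
\<close>

lemma nowhere_zero_orthogonal:
  assumes "k \<ge> 1"
  obtains U :: "nat \<Rightarrow> nat \<Rightarrow> real" where
    "\<And>i j. U i j \<noteq> 0" "\<And>i j. U i j = U j i"
    "\<And>i j. i < k \<Longrightarrow> j < k \<Longrightarrow> (\<Sum>l<k. U i l * U j l) = of_bool (i = j)"
proof -
  define v :: "nat \<Rightarrow> real" where "v i = sqrt (2 ^ i / (2 ^ k - 1))" for i
  define U where "U i j = of_bool (i = j) - 2 * v i * v j" for i j
  have pos: "(2::real) ^ k - 1 > 0" using assms by simp
  have v2: "v i * v i = 2 ^ i / (2 ^ k - 1)" for i using pos by (simp add: v_def)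
  have vpos: "v i > 0" for i using pos by (simp add: v_def)
  have norm: "(\<Sum>l<k. v l * v l) = 1"
    using pos by (simp add: v2 sum_divide_distrib[symmetric] power_diff_1_eq)
  have "U i j \<noteq> 0" for i j
  proof (cases "i = j")
    case True
    have "\<not> 2 * 2 ^ i = (2::real) ^ k - 1"
    proof
      assume "2 * 2 ^ i = (2::real) ^ k - 1"
      then have "real (2 * 2 ^ i + 1) = real (2 ^ k)" by simp
      then have eq: "2 * 2 ^ i + 1 = (2::nat) ^ k" by (simp only: of_nat_eq_iff)
      have "odd (2 * 2 ^ i + 1 :: nat)" by simp
      with assms show False unfolding eq by simp
    qed
    then have "2 * (v i * v i) \<noteq> 1" using pos by (simp add: v2 field_simps)
    with True show ?thesis by (simp add: U_def mult.assoc)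
  next
    case False
    with vpos[of i] vpos[of j] show ?thesis by (simp add: U_def)
  qed
  moreover have "U i j = U j i" for i j by (auto simp: U_def)
  moreover have "(\<Sum>l<k. U i l * U j l) = of_bool (i = j)" if "i < k" "j < k" for i j
  proof -
    \<comment> \<open>Expanding the product leaves two cross terms, each contributing
      \<open>- 2 * v i * v j\<close>, and a rank-one term that cancels them because \<open>v\<close>
      has norm 1.\<close>
    have "(\<Sum>l<k. U i l * U j l) = (\<Sum>l<k. (if l = i then of_bool (i = j) else 0)
        - (if l = i then 2 * v i * v j else 0) - (if l = j then 2 * v i * v j else 0)
        + 4 * v i * v j * (v l * v l))"
      by (intro sum.cong refl) (auto simp: U_def algebra_simps)
    also have "\<dots> = of_bool (i = j) - 2 * v i * v j - 2 * v i * v j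
        + 4 * v i * v j * (\<Sum>l<k. v l * v l)"
      using that by (simp add: sum.distrib sum_subtractf sum_distrib_left)
    finally show ?thesis by (simp add: norm)
  qed
  ultimately show thesis by (rule that)
qed

section \<open>From an edge colouring to an involution\<close>

text \<open>Lets matrix products be computed with entries indexed by vertices instead of
  numbers.\<close>

lemma mult_mat_reindex:
  fixes M N :: "'b \<Rightarrow> 'b \<Rightarrow> 'a::semiring_0"
  assumes "bij_betw f {0..<n} S"
  shows "mat n n (\<lambda>(i, j). M (f i) (f j)) * mat n n (\<lambda>(i, j). N (f i) (f j))
    = mat n n (\<lambda>(i, j). \<Sum>x\<in>S. M (f i) x * N x (f j))"
  by (rule eq_matI) (simp_all add: scalar_prod_def sum.reindex_bij_betw[OF assms, symmetric])

lemma proper_edge_coloring_less: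
  assumes "proper_edge_coloring G m c" "(u, v) \<in> parcs G"
  shows "c {u, v} < m"
proof -
  have "{u, v} \<in> edges G" using assms(2) unfolding edges_def by blast
  then show ?thesis using assms(1) unfolding proper_edge_coloring_def by blast
qed

text \<open>The \<open>k\<close> edges at \<open>v\<close> get distinct colours out of
  \<open>k\<close>, so each colour occurs exactly once: every colour class is a perfect
  matching.\<close>

lemma proper_edge_coloring_neighbours:
  assumes G: "pair_graph G" and reg: "regular_graph k G" and c: "proper_edge_coloring G k c"
    and v: "v \<in> pverts G"
  shows "bij_betw (\<lambda>w. c {v, w}) {w. (v, w) \<in> parcs G} {..<k}"
proof -
  interpret pair_graph G by fact
  let ?N = "{w. (v, w) \<in> parcs G}"
  have "out_arcs (with_proj G) v = Pair v ` ?N" by (auto simp: out_arcs_def)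
  then have "card ?N = out_degree (with_proj G) v"
    by (simp add: out_degree_def card_image inj_on_def)
  then have card: "card ?N = k" using reg v by (simp add: regular_graph_def)
  have inj: "inj_on (\<lambda>w. c {v, w}) ?N"
  proof (rule inj_onI, rule ccontr)
    fix w w' assume w: "w \<in> ?N" "w' \<in> ?N" "c {v, w} = c {v, w'}" "w \<noteq> w'"
    then have "{v, w} \<in> edges G" "{v, w'} \<in> edges G" "{v, w} \<noteq> {v, w'}"
      by (auto simp: edges_def doubleton_eq_iff)
    moreover have "{v, w} \<inter> {v, w'} \<noteq> {}" by simp
    ultimately have "c {v, w} \<noteq> c {v, w'}" using c by (simp add: proper_edge_coloring_def)
    with w(3) show False by simp
  qed
  have "(\<lambda>w. c {v, w}) ` ?N \<subseteq> {..<k}"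
    using proper_edge_coloring_less[OF c] by auto
  then have "(\<lambda>w. c {v, w}) ` ?N = {..<k}"
    by (intro card_subset_eq) (auto simp: card_image[OF inj] card)
  with inj show ?thesis by (simp add: bij_betw_def)
qed

text \<open>Two vertices of a complete graph are equal or adjacent, so the second coordinates impose
  no condition.\<close>

lemma parcs_modified_strong_product_complete:
  assumes "complete_digraph k (with_proj K)" "h \<in> pverts K" "h' \<in> pverts K"
  shows "((g, h), (g', h')) \<in> parcs (modified_strong_product G K) \<longleftrightarrow> (g, g') \<in> parcs G"
proof -
  have "parcs K = {(u, v). u \<in> pverts K \<and> v \<in> pverts K \<and> u \<noteq> v}"
    using assms(1) by (auto simp: complete_digraph_def)
  then show ?thesis using assms(2,3) by (auto simp: modified_strong_product_def)
qed

lemma involution_on_modified_strong_product: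
  fixes G :: "'a pair_pre_digraph" and K :: "'b pair_pre_digraph"
  assumes k: "k \<ge> 1" and G: "pair_graph G" and reg: "regular_graph k G"
    and ci: "chromatic_index G = k" and K: "complete_digraph k (with_proj K)"
  obtains A where "A \<in> sym_matrices (modified_strong_product G K)" "A * A = 1\<^sub>m (dim_row A)"
proof -
  interpret pair_graph G by fact
  obtain U :: "nat \<Rightarrow> nat \<Rightarrow> real" where nz: "\<And>i j. U i j \<noteq> 0" and comm: "\<And>i j. U i j = U j i"
    and orth: "\<And>i j. i < k \<Longrightarrow> j < k \<Longrightarrow> (\<Sum>l<k. U i l * U j l) = of_bool (i = j)"
    using nowhere_zero_orthogonal[OF k] by blast
  obtain c where c: "proper_edge_coloring G k c" using chromatic_index_attained[OF G] ci by auto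
  have cK: "card (pverts K) = k" using K by (simp add: complete_digraph_def)
  \<comment> \<open>An infinite set has \<open>card\<close> 0, which \<open>k \<ge> 1\<close>
    excludes.\<close>
  then have finK: "finite (pverts K)" using k by (metis card.infinite not_one_le_zero)
  obtain b where b: "bij_betw b (pverts K) {..<k}"
    using ex_bij_betw_finite_nat[OF finK] cK by (auto simp: atLeast0LessThan)
  have blt: "b h < k" if "h \<in> pverts K" for h using bij_betwE[OF b] that by auto
  have sym_arc: "(g, g') \<in> parcs G \<longleftrightarrow> (g', g) \<in> parcs G" for g g'
    using pair_sym_arcs by (auto simp: symmetric_def sym_def)
  \<comment> \<open>The entries of the Kronecker sum: an edge lies in the matching of its own colour
    only, so a single projection contributes, namely the one onto that row of \<open>U\<close>. The
    bijection \<open>b\<close> numbers the coordinates by vertices of \<open>K\<close>.\<close>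
  define M where "M x y = (if (fst x, fst y) \<in> parcs G
      then U (c {fst x, fst y}) (b (snd x)) * U (c {fst x, fst y}) (b (snd y)) else 0)"
    for x y :: "'a \<times> 'b"
  have Mswap: "M y x = M x y" for x y
    by (simp add: M_def sym_arc[of "fst y"] insert_commute mult.commute)
  let ?V = "pverts G \<times> pverts K"
  have fin: "finite ?V" using pair_finite_verts finK by simp
  have clt: "c {g, g'} < k" if "(g, g') \<in> parcs G" for g g'
    using proper_edge_coloring_less[OF c that] .
  have sq: "(\<Sum>x\<in>?V. M (g, h) x * M x (g', h')) = of_bool ((g, h) = (g', h'))"
    if g: "g \<in> pverts G" "g' \<in> pverts G" and h: "h \<in> pverts K" "h' \<in> pverts K" for g h g' h'
  proof -
    let ?N = "{w. (g, w) \<in> parcs G}"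
    have Nsub: "?N \<subseteq> pverts G" by (auto dest: wellformed')
    \<comment> \<open>Summing over the second coordinate takes the inner product of two rows of
      \<open>U\<close>, which vanishes unless the edges \<open>gw\<close> and \<open>wg'\<close>
      have the same colour.\<close>
    have inner: "(\<Sum>y\<in>pverts K. M (g, h) (w, y) * M (w, y) (g', h')) =
        (if w \<in> ?N then of_bool (g = g') * (U (b h) (c {g, w}) * U (b h') (c {g, w})) else 0)"
      for w
    proof (cases "(g, w) \<in> parcs G \<and> (w, g') \<in> parcs G")
      case True
      have "(\<Sum>y\<in>pverts K. M (g, h) (w, y) * M (w, y) (g', h')) =
          U (b h) (c {g, w}) * U (b h') (c {w, g'}) *
          (\<Sum>y\<in>pverts K. U (c {g, w}) (b y) * U (c {w, g'}) (b y))"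
        unfolding sum_distrib_left using True
        by (intro sum.cong refl) (simp add: M_def comm[of "b h"] comm[of "b h'"])
      also have "(\<Sum>y\<in>pverts K. U (c {g, w}) (b y) * U (c {w, g'}) (b y)) =
          (\<Sum>l<k. U (c {g, w}) l * U (c {w, g'}) l)"
        by (rule sum.reindex_bij_betw[OF b])
      also have "\<dots> = of_bool (c {g, w} = c {w, g'})" using True by (intro orth clt) auto
      \<comment> \<open>Only one edge at \<open>w\<close> carries a given colour.\<close>
      also have "c {g, w} = c {w, g'} \<longleftrightarrow> g = g'"
      proof -
        have w: "w \<in> pverts G" using True Nsub by auto
        have "inj_on (\<lambda>x. c {w, x}) {x. (w, x) \<in> parcs G}"
          using proper_edge_coloring_neighbours[OF G reg c w] by (rule bij_betw_imp_inj_on)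
        then show ?thesis
          using True sym_arc[of g w] by (auto simp: inj_on_def insert_commute)
      qed
      finally show ?thesis using True by (auto simp: insert_commute)
    next
      case False
      then show ?thesis using sym_arc[of w g] by (auto simp: M_def)
    qed
    have "(\<Sum>x\<in>?V. M (g, h) x * M x (g', h')) =
        (\<Sum>w\<in>pverts G. \<Sum>y\<in>pverts K. M (g, h) (w, y) * M (w, y) (g', h'))"
      by (simp add: sum.cartesian_product)
    also have "\<dots> = (\<Sum>w\<in>?N. of_bool (g = g') * (U (b h) (c {g, w}) * U (b h') (c {g, w})))"
      unfolding inner sum.inter_restrict[OF pair_finite_verts, symmetric] Int_absorb1[OF Nsub] ..
    \<comment> \<open>As \<open>w\<close> runs through the neighbours of \<open>g\<close>, the
      colour runs once through all of \<open>{..<k}\<close>. Symmetry of \<open>U\<close> has turned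
      the columns into rows, so \<open>orth\<close> applies a second time.\<close>
    also have "\<dots> = of_bool (g = g') * (\<Sum>l<k. U (b h) l * U (b h') l)"
      unfolding sum_distrib_left[symmetric]
      by (subst sum.reindex_bij_betw[OF proper_edge_coloring_neighbours[OF G reg c g(1)],
            of "\<lambda>l. U (b h) l * U (b h') l"]) rule
    also have "\<dots> = of_bool ((g, h) = (g', h'))"
      using h b by (auto simp: orth blt bij_betw_def inj_on_def)
    finally show ?thesis .
  qed
  let ?n = "card ?V"
  obtain f where f: "bij_betw f {0..<?n} ?V" using ex_bij_betw_nat_finite[OF fin] by blast
  define A where "A = mat ?n ?n (\<lambda>(i, j). M (f i) (f j))"
  have fV: "f i \<in> ?V" if "i < ?n" for i using bij_betwE[OF f] that by auto
  have "A * A = mat ?n ?n (\<lambda>(i, j). \<Sum>x\<in>?V. M (f i) x * M x (f j))"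
    unfolding A_def by (rule mult_mat_reindex[OF f])
  also have "\<dots> = 1\<^sub>m ?n"
  proof (rule eq_matI)
    fix i j assume "i < dim_row (1\<^sub>m ?n)" "j < dim_col (1\<^sub>m ?n)"
    then have ij: "i < ?n" "j < ?n" by auto
    have "f i = f j \<longleftrightarrow> i = j" using f ij by (auto simp: bij_betw_def inj_on_def)
    then show "mat ?n ?n (\<lambda>(i, j). \<Sum>x\<in>?V. M (f i) x * M x (f j)) $$ (i, j) = 1\<^sub>m ?n $$ (i, j)"
      using ij fV[of i] fV[of j] sq[of "fst (f i)" "fst (f j)" "snd (f i)" "snd (f j)"]
      by (auto simp: mem_Times_iff)
  qed auto
  finally have "A * A = 1\<^sub>m (dim_row A)" by (simp add: A_def)
  moreover have "A \<in> sym_matrices (modified_strong_product G K)"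
  proof -
    have V: "pverts (modified_strong_product G K) = ?V" by (simp add: modified_strong_product_def)
    have "transpose_mat A = A" by (intro eq_matI) (auto simp: A_def Mswap)
    moreover have "A $$ (i, j) \<noteq> 0 \<longleftrightarrow> (f i, f j) \<in> parcs (modified_strong_product G K)"
      if "i < ?n" "j < ?n" for i j
      using that fV[of i] fV[of j]
        parcs_modified_strong_product_complete[OF K, of "snd (f i)" "snd (f j)" "fst (f i)" "fst (f j)" G]
      by (auto simp: A_def M_def nz mem_Times_iff)
    moreover have "A \<in> carrier_mat ?n ?n" by (simp add: A_def)
    ultimately show ?thesis using f unfolding sym_matrices_def V by blast
  qed
  ultimately show thesis using that by blast
qed

section \<open>Lower bound and conclusion\<close>

text \<open>An arc joins two distinct vertices, so any labelling turns it into a nonzero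
  off-diagonal entry.\<close>

lemma two_le_q_mat_sym_matrices:
  assumes "pair_graph G" "parcs G \<noteq> {}" "A \<in> sym_matrices G"
  shows "2 \<le> q_mat A"
proof -
  interpret pair_graph G by fact
  from assms(3) obtain f where A: "A \<in> carrier_mat (card (pverts G)) (card (pverts G))"
    and sym: "transpose_mat A = A" and f: "bij_betw f {0..<card (pverts G)} (pverts G)"
    and pat: "\<And>i j. i < card (pverts G) \<Longrightarrow> j < card (pverts G) \<Longrightarrow> i \<noteq> j \<Longrightarrow>
      A $$ (i, j) \<noteq> 0 \<longleftrightarrow> (f i, f j) \<in> parcs G"
    unfolding sym_matrices_def by blast
  obtain u v where uv: "(u, v) \<in> parcs G" using assms(2) by auto
  then have "u \<in> f ` {0..<card (pverts G)}" "v \<in> f ` {0..<card (pverts G)}" "u \<noteq> v"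
    using f pair_no_loops by (fastforce simp: bij_betw_def dest: wellformed')+
  then obtain i j where "i < card (pverts G)" "j < card (pverts G)" "u = f i" "v = f j"
    by auto
  moreover from this have "i \<noteq> j" using \<open>u \<noteq> v\<close> by auto
  ultimately show ?thesis using pat[of i j] uv by (intro two_le_q_mat[OF A sym]) auto
qed

theorem theorem3p1:
  fixes G :: "'a pair_pre_digraph" and K :: "'b pair_pre_digraph" and k :: nat
  assumes "k \<ge> 1"
    and "pair_graph G"
    and "regular_graph k G"
    and "chromatic_index G = k"
    and "complete_digraph k (with_proj K)"
  shows "q_graph (modified_strong_product G K) = 2"
proof -
  let ?P = "modified_strong_product G K"
  have "pair_graph K" using assms(5)
    by (simp add: complete_digraph_def pair_graphI_graph)
  then have P: "pair_graph ?P" using assms(2) by (intro pair_graph_modified_strong_product)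
  \<comment> \<open>Without arcs, zero colours would suffice, against
    \<open>k \<ge> 1\<close>.\<close>
  have "parcs G \<noteq> {}"
  proof
    assume "parcs G = {}"
    then have "proper_edge_coloring G 0 c" for c
      by (auto simp: proper_edge_coloring_def edges_def)
    then have "chromatic_index G \<le> 0" unfolding chromatic_index_def by (intro Least_le) blast
    with assms(1,4) show False by simp
  qed
  then obtain g g' where "(g, g') \<in> parcs G" by auto
  moreover obtain h where "h \<in> pverts K"
    using assms(1,5) by (fastforce simp: complete_digraph_def)
  ultimately have "((g, h), (g', h)) \<in> parcs ?P"
    by (simp add: parcs_modified_strong_product_complete[OF assms(5)])
  then have arcs: "parcs ?P \<noteq> {}" by auto
  obtain A where A: "A \<in> sym_matrices ?P" "A * A = 1\<^sub>m (dim_row A)"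
    using involution_on_modified_strong_product[OF assms] .
  have "A \<in> carrier_mat (dim_row A) (dim_row A)" using A(1) by (auto simp: sym_matrices_def)
  then have "q_mat A = 2"
    by (intro le_antisym q_mat_le_two[OF _ A(2)] two_le_q_mat_sym_matrices[OF P arcs A(1)])
  with A(1) have "\<exists>A\<in>sym_matrices ?P. q_mat A = 2" by blast
  then show ?thesis
    unfolding q_graph_def
    by (rule Least_equality) (auto dest: two_le_q_mat_sym_matrices[OF P arcs])
qed

end
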